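(* Let $\bm{\mu}=(\mu_1,\dots,\mu_r)$ be an Angelesco system on the unit circle, with arcs $\Gamma_1,\dots,\Gamma_r$ ordered with respect to $t_0\in\mathbb{R}$ as described in the context, with the branch of the square root determined by this $t_0$, and such that $\mu_r(\{e^{it_0}\})=0$. Then every multi-index $\bm{n}\in\mathbb{N}^r$ is normal (i.e. $\phi$-normal) with respect to $\bm{\mu}$.
   Context: $\mathbb{N}=\{0,1,2,\dots\}$; $\partial\mathbb{D}=\{z\in\mathbb{C}:|z|=1\}$; for $\bm{n}=(n_1,\dots,n_r)\in\mathbb{N}^r$, $|\bm{n}|=n_1+\dots+n_r$. Angelesco system: each $\mu_j$ ($j=1,\dots,r$) is a probability measure on $\partial\mathbb{D}$ with infinite support, and there exist closed arcs $\Gamma_j\subset\partial\mathbb{D}$ with $\operatorname{supp}\mu_j\subseteq\Gamma_j$ and such that $\Gamma_j\cap\Gamma_k$ has $0$, $1$ or $2$ points whenever $j\ne k$. Ordering convention: the measures are labelled and $t_0\in\mathbb{R}$ is fixed so that $\Gamma_j=\{e^{i\theta}:\alpha_j\le\theta\le\beta_j\}$ with $t_0\le\alpha_1\le\beta_1\le\alpha_2\le\beta_2\le\dots\le\alpha_r\le\beta_r\le t_0+2\pi$. Branch: $z^{1/2}=|z|^{1/2}\exp(\tfrac{i}{2}\arg z)$ with $\arg z\in[t_0,t_0+2\pi)$; for $m\in\mathbb{Z}$, $z^{m/2}:=(z^{1/2})^m$. Normality: $\bm{n}$ is $\phi$-normal (or simply normal) with respect to $\bm{\mu}$ if there exists a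 unique function of the form $$\phi_{\bm{n}}(z)=z^{|\bm{n}|/2}+\kappa_{|\bm{n}|/2-1}z^{|\bm{n}|/2-1}+\dots+\kappa_{-|\bm{n}|/2}z^{-|\bm{n}|/2}$$ (complex coefficients, exponents decreasing in steps of $1$) satisfying, for every $j=1,\dots,r$, $$\int\phi_{\bm{n}}(z)z^{-k}\,d\mu_j(z)=0,\qquad k=-\tfrac{n_j}{2},-\tfrac{n_j}{2}+1,\dots,\tfrac{n_j}{2}-1$$ (no condition for $j$ if $n_j=0$). The index $\bm{0}$ is normal, with $\phi_{\bm{0}}=1$. *)

theory Defs
  imports "HOL-Probability.Probability"
begin

definition circle_prob :: "complex measure \<Rightarrow> bool" where
  "circle_prob \<mu> \<longleftrightarrow> prob_space \<mu> \<and> sets \<mu> = sets (restrict_space borel (sphere (0::complex) 1))"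

definition circle_supp :: "complex measure \<Rightarrow> complex set" where
  "circle_supp \<mu> = {z \<in> sphere 0 1. \<forall>U. open U \<longrightarrow> z \<in> U \<longrightarrow> 0 < measure \<mu> (U \<inter> sphere 0 1)}"

definition arc_set :: "real \<Rightarrow> real \<Rightarrow> complex set" where
  "arc_set a b = cis ` {a..b}"

text \<open>The whole circle (\<open>b = a + 2 * pi\<close>) counts as a closed arc.\<close>

definition closed_arc :: "complex set \<Rightarrow> bool" where
  "closed_arc A \<longleftrightarrow> (\<exists>a b. a \<le> b \<and> b \<le> a + 2 * pi \<and> A = arc_set a b)"

text \<open>Families indexed by \<open>1, \<dots>, r\<close> are functions on \<^typ>\<open>nat\<close> whose values outside
  \<open>{1..r}\<close> are irrelevant.\<close>

definition angelesco_system :: "nat \<Rightarrow> (nat \<Rightarrow> complex measure) \<Rightarrow> (nat \<Rightarrow> complex set) \<Rightarrow> bool" where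
  "angelesco_system r \<mu> \<Gamma> \<longleftrightarrow>
     (\<forall>j\<in>{1..r}. circle_prob (\<mu> j) \<and> infinite (circle_supp (\<mu> j)) \<and>
                 closed_arc (\<Gamma> j) \<and> circle_supp (\<mu> j) \<subseteq> \<Gamma> j) \<and>
     (\<forall>j\<in>{1..r}. \<forall>k\<in>{1..r}. j \<noteq> k \<longrightarrow> finite (\<Gamma> j \<inter> \<Gamma> k) \<and> card (\<Gamma> j \<inter> \<Gamma> k) \<le> 2)"

definition ordered_arcs :: "real \<Rightarrow> nat \<Rightarrow> (nat \<Rightarrow> complex set) \<Rightarrow> bool" where
  "ordered_arcs t0 r \<Gamma> \<longleftrightarrow>
     (\<exists>\<alpha> \<beta>. (\<forall>j\<in>{1..r}. \<Gamma> j = arc_set (\<alpha> j) (\<beta> j) \<and> \<alpha> j \<le> \<beta> j) \<and>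
            t0 \<le> \<alpha> 1 \<and> (\<forall>j\<in>{1..<r}. \<beta> j \<le> \<alpha> (Suc j)) \<and> \<beta> r \<le> t0 + 2 * pi)"

text \<open>The argument is unspecified at \<open>z = 0\<close>, where the square root below is nevertheless \<open>0\<close>.\<close>

definition arg_from :: "real \<Rightarrow> complex \<Rightarrow> real" where
  "arg_from t0 z = (THE \<theta>. t0 \<le> \<theta> \<and> \<theta> < t0 + 2 * pi \<and> z = of_real (cmod z) * cis \<theta>)"

definition sqrt_from :: "real \<Rightarrow> complex \<Rightarrow> complex" where
  "sqrt_from t0 z = of_real (sqrt (cmod z)) * exp (\<i> / 2 * of_real (arg_from t0 z))"

text \<open>\<open>half_pow t0 m z\<close> is \<open>z\<close> to the power \<open>m/2\<close>.\<close>

definition half_pow :: "real \<Rightarrow> int \<Rightarrow> complex \<Rightarrow> complex" where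
  "half_pow t0 m z = sqrt_from t0 z powi m"

definition index_size :: "nat \<Rightarrow> (nat \<Rightarrow> nat) \<Rightarrow> nat" where
  "index_size r n = (\<Sum>j=1..r. n j)"

text \<open>In the functions below \<open>\<kappa> l\<close> is the coefficient of \<open>z\<close> to the power \<open>N/2 - l\<close>.\<close>

definition phi_form :: "real \<Rightarrow> nat \<Rightarrow> (complex \<Rightarrow> complex) \<Rightarrow> bool" where
  "phi_form t0 N \<phi> \<longleftrightarrow>
     (\<exists>\<kappa>. \<phi> = (\<lambda>z. half_pow t0 (int N) z + (\<Sum>l=1..N. \<kappa> l * half_pow t0 (int N - 2 * int l) z)))"

text \<open>The orthogonality exponents are \<open>k = - n j / 2 + l\<close> for \<open>l < n j\<close>, so that \<open>- k\<close> is
  \<open>(n j - 2 * l) / 2\<close>. The integrands are bounded and measurable on the circle, hence integrable.\<close>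

definition phi_normal :: "real \<Rightarrow> nat \<Rightarrow> (nat \<Rightarrow> complex measure) \<Rightarrow> (nat \<Rightarrow> nat) \<Rightarrow> bool" where
  "phi_normal t0 r \<mu> n \<longleftrightarrow>
     (\<exists>!\<phi>. phi_form t0 (index_size r n) \<phi> \<and>
           (\<forall>j\<in>{1..r}. \<forall>l<n j.
              integral\<^sup>L (\<mu> j) (\<lambda>z. \<phi> z * half_pow t0 (int (n j) - 2 * int l) z) = 0))"

end

theory Submission
  imports Defs
begin

text \<open>
  Normality is the unique solvability of a square linear system, so it suffices that the homogeneous
  system has only the trivial solution. Such a solution, multiplied by \<open>z\<close> to the power \<open>1/2\<close>, is on
  the circle a trigonometric polynomial \<open>\<psi>\<close> in \<open>\<theta>/2\<close> of order \<open>N - 1\<close>, and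
  it is orthogonal with respect to \<open>\<mu> j\<close> to all those of order \<open>n j - 1\<close>. The real part of any
  multiple of \<open>\<psi>\<close> inherits both properties. If it had fewer than \<open>n j\<close> zeros inside the \<open>j\<close>-th arc,
  its sign changes there could be cancelled by a product of factors \<open>sin ((\<theta> - c) / 2)\<close> of order
  \<open>n j - 1\<close>, contradicting orthogonality because \<open>\<mu> j\<close> has infinite support. So it has at least
  \<open>N\<close> zeros in one period, while a nonzero function of this kind has at most \<open>N - 1\<close>.
\<close>

section \<open>Linear algebra: homogeneous systems with more unknowns than equations\<close>

text \<open>Gaussian elimination by induction on the equations. If equation \<open>k\<close> has a
  nonzero entry at \<open>p\<close>, it expresses the unknown \<open>p\<close> through the others;
  one equation and one unknown disappear, so the strict inequality of cardinalities
  survives.\<close>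

lemma underdetermined_system:
  fixes a :: "'i \<Rightarrow> 'j \<Rightarrow> 'a::field"
  assumes "finite I" "finite J" "card I < card J"
  shows "\<exists>x. (\<exists>j\<in>J. x j \<noteq> 0) \<and> (\<forall>i\<in>I. (\<Sum>j\<in>J. a i j * x j) = 0)"
  using assms
proof (induction I arbitrary: J a rule: finite_induct)
  case empty
  then have "J \<noteq> {}" by auto
  then show ?case by (intro exI[of _ "\<lambda>_. 1"]) auto
next
  case (insert k I)
  show ?case
  proof (cases "\<forall>j\<in>J. a k j = 0")
    case True
    obtain x where "\<exists>j\<in>J. x j \<noteq> 0" "\<forall>i\<in>I. (\<Sum>j\<in>J. a i j * x j) = 0"
      using insert.IH[of J a] insert.prems insert.hyps by auto
    with True show ?thesis by (intro exI[of _ x]) auto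
  next
    case False
    then obtain p where p: "p \<in> J" "a k p \<noteq> 0" by blast
    define J' where "J' = J - {p}"
    \<comment> \<open>Row \<open>i\<close> minus the multiple of row \<open>k\<close> that clears
      the pivot column \<open>p\<close>.\<close>
    define a' where "a' i j = a i j - a i p * a k j / a k p" for i j
    have J: "J = insert p J'" "p \<notin> J'" "finite J'"
      using p insert.prems by (auto simp: J'_def)
    have "card I < card J'" using insert.prems insert.hyps J by auto
    then obtain x where x: "\<exists>j\<in>J'. x j \<noteq> 0" "\<forall>i\<in>I. (\<Sum>j\<in>J'. a' i j * x j) = 0"
      using insert.IH[of J' a'] J(3) by auto
    \<comment> \<open>The value at \<open>p\<close> is the one forced by equation \<open>k\<close>;
      with it, the old rows at \<open>y\<close> agree with the reduced rows at
      \<open>x\<close>.\<close>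
    define y where "y = x(p := - (\<Sum>j\<in>J'. a k j * x j) / a k p)"
    have sum: "(\<Sum>j\<in>J. a i j * y j) = (\<Sum>j\<in>J'. a' i j * x j)" for i
    proof -
      have "(\<Sum>j\<in>J. a i j * y j) = a i p * y p + (\<Sum>j\<in>J'. a i j * y j)"
        using J by simp
      also have "(\<Sum>j\<in>J'. a i j * y j) = (\<Sum>j\<in>J'. a i j * x j)"
        using J by (intro sum.cong) (auto simp: y_def)
      also have "a i p * y p = - (\<Sum>j\<in>J'. a i p * a k j / a k p * x j)"
        by (simp add: y_def sum_distrib_left sum_divide_distrib algebra_simps)
      finally show ?thesis
        by (simp add: a'_def algebra_simps sum_subtractf)
    qed
    have "\<exists>j\<in>J. y j \<noteq> 0" using x(1) J by (auto simp: y_def)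
    moreover have "(\<Sum>j\<in>J. a k j * y j) = 0" using p by (simp add: sum a'_def)
    ultimately show ?thesis using x(2) by (intro exI[of _ y]) (auto simp: sum)
  qed
qed

section \<open>Trigonometric polynomials in half the angle\<close>

text \<open>Linear combinations of \<open>exp (i k \<theta> / 2)\<close> with \<open>k = -M, -M + 2, \<dots>, M\<close>.\<close>

definition half_trig_poly :: "nat \<Rightarrow> (real \<Rightarrow> complex) \<Rightarrow> bool" where
  "half_trig_poly M f \<longleftrightarrow>
     (\<exists>p. degree p \<le> M \<and> (\<forall>\<theta>. f \<theta> = cis (- (real M * \<theta> / 2)) * poly p (cis \<theta>)))"

lemma cis_inj_interval:
  assumes "cis x = cis y" "t0 \<le> x" "x < t0 + 2 * pi" "t0 \<le> y" "y < t0 + 2 * pi"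
  shows "x = y"
proof -
  obtain n :: int where n: "y = x + 2 * pi * n"
    using assms(1) sin_cos_eq_iff[of y x] by (auto simp: complex_eq_iff)
  have "\<bar>2 * pi * real_of_int n\<bar> < 2 * pi * 1"
    using assms(2-5) n by linarith
  then have "2 * pi * \<bar>real_of_int n\<bar> < 2 * pi * 1"
    by (simp only: abs_mult) simp
  then have "\<bar>real_of_int n\<bar> < 1" by (simp only: mult_less_cancel_left) simp
  then have "n = 0" by linarith
  with n show ?thesis by simp
qed

text \<open>The prefactor \<open>cis\<close> never vanishes, so zeros of \<open>f\<close> are
  exactly the angles at which \<open>poly p (cis \<theta>)\<close> is zero. Since \<open>cis\<close>
  is injective on a half-open period, they inject into the roots of \<open>p\<close>.\<close>

lemma half_trig_poly_zeros:
  assumes "half_trig_poly M f" "f \<theta>' \<noteq> 0"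
  shows "finite {\<theta>. t0 \<le> \<theta> \<and> \<theta> < t0 + 2 * pi \<and> f \<theta> = 0}" (is "finite ?Z")
    and "card {\<theta>. t0 \<le> \<theta> \<and> \<theta> < t0 + 2 * pi \<and> f \<theta> = 0} \<le> M"
proof -
  obtain p where p: "degree p \<le> M" "\<And>\<theta>. f \<theta> = cis (- (real M * \<theta> / 2)) * poly p (cis \<theta>)"
    using assms(1) by (auto simp: half_trig_poly_def)
  have "p \<noteq> 0" using assms(2) p(2) by auto
  have inj: "inj_on cis ?Z" by (auto intro!: inj_onI intro: cis_inj_interval)
  have sub: "cis ` ?Z \<subseteq> {w. poly p w = 0}" using p(2) by auto
  have fin: "finite {w. poly p w = 0}" using \<open>p \<noteq> 0\<close> by (rule poly_roots_finite)
  show "finite ?Z" using finite_imageD[OF finite_subset[OF sub fin] inj] .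
  have "card ?Z = card (cis ` ?Z)" using inj by (simp add: card_image)
  also have "\<dots> \<le> card {w. poly p w = 0}" using sub fin by (rule card_mono[rotated])
  also have "\<dots> \<le> degree p" using \<open>p \<noteq> 0\<close> by (rule card_poly_roots_bound)
  finally show "card ?Z \<le> M" using p(1) by simp
qed

lemma half_trig_poly_mult:
  assumes "half_trig_poly M f" "half_trig_poly N g"
  shows "half_trig_poly (M + N) (\<lambda>\<theta>. f \<theta> * g \<theta>)"
proof -
  obtain p q where p: "degree p \<le> M" "\<And>\<theta>. f \<theta> = cis (- (real M * \<theta> / 2)) * poly p (cis \<theta>)"
    and q: "degree q \<le> N" "\<And>\<theta>. g \<theta> = cis (- (real N * \<theta> / 2)) * poly q (cis \<theta>)"
    using assms by (auto simp: half_trig_poly_def)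
  have "degree (p * q) \<le> M + N" using p(1) q(1) degree_mult_le[of p q] by linarith
  moreover have "cis (- (real (M + N) * \<theta> / 2)) = cis (- (real M * \<theta> / 2)) * cis (- (real N * \<theta> / 2))" for \<theta>
    by (simp add: cis_mult algebra_simps add_divide_distrib)
  ultimately show ?thesis unfolding half_trig_poly_def
    by (intro exI[of _ "p * q"]) (simp add: p(2) q(2))
qed

lemma half_trig_poly_const: "half_trig_poly 0 (\<lambda>_. c)"
  unfolding half_trig_poly_def by (intro exI[of _ "[:c:]"]) simp

lemma half_trig_poly_cmult:
  assumes "half_trig_poly M f" shows "half_trig_poly M (\<lambda>\<theta>. c * f \<theta>)"
  using half_trig_poly_mult[OF half_trig_poly_const assms] by simp

lemma half_trig_poly_sin: "half_trig_poly 1 (\<lambda>\<theta>. of_real (sin ((\<theta> - a) / 2)))"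
  unfolding half_trig_poly_def
proof (intro exI conjI allI)
  let ?p = "[: - cis (a / 2) / (2 * \<i>), cis (- (a / 2)) / (2 * \<i>) :]"
  show "degree ?p \<le> 1" by simp
  fix \<theta>
  have eq: "cis (- (\<theta> / 2)) * cis (a / 2) = cis (- ((\<theta> - a) / 2))"
     "cis (- (\<theta> / 2)) * (cis \<theta> * cis (- (a / 2))) = cis ((\<theta> - a) / 2)"
    unfolding cis_mult by (rule arg_cong[where f = cis], simp add: field_simps)+
  have "cis (- (real 1 * \<theta> / 2)) * poly ?p (cis \<theta>) =
      (cis (- (\<theta> / 2)) * (cis \<theta> * cis (- (a / 2))) - cis (- (\<theta> / 2)) * cis (a / 2)) / (2 * \<i>)"
    by (simp add: algebra_simps diff_divide_distrib)
  also have "\<dots> = of_real (sin ((\<theta> - a) / 2))"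
    unfolding eq by (simp add: complex_eq_iff)
  finally show "of_real (sin ((\<theta> - a) / 2)) = cis (- (real 1 * \<theta> / 2)) * poly ?p (cis \<theta>)" ..
qed

lemma half_trig_poly_prod_sin:
  assumes "finite A"
  shows "half_trig_poly (card A) (\<lambda>\<theta>. of_real (\<Prod>c\<in>A. sin ((\<theta> - c) / 2)))"
  using assms
proof (induction rule: finite_induct)
  case empty
  show ?case using half_trig_poly_const[of 1] by simp
next
  case (insert c A)
  then show ?case using half_trig_poly_mult[OF half_trig_poly_sin insert.IH, of c] by simp
qed

lemma half_trig_poly_sin_power:
  "half_trig_poly m (\<lambda>\<theta>. of_real (sin ((\<theta> - a) / 2) ^ m))"
proof (induction m)
  case 0
  show ?case using half_trig_poly_const[of 1] by simp
next
  case (Suc m)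
  then show ?case using half_trig_poly_mult[OF half_trig_poly_sin Suc.IH, of a] by simp
qed

text \<open>The exponents from \<open>-M\<close> to \<open>M\<close> are symmetric about 0, so the
  space is closed under conjugation and contains the real part as the mean of \<open>f\<close> and
  \<open>cnj (f \<theta>)\<close>.\<close>

lemma half_trig_poly_Re:
  assumes "half_trig_poly M f"
  shows "half_trig_poly M (\<lambda>\<theta>. of_real (Re (f \<theta>)))"
proof -
  obtain p where p: "degree p \<le> M" "\<And>\<theta>. f \<theta> = cis (- (real M * \<theta> / 2)) * poly p (cis \<theta>)"
    using assms by (auto simp: half_trig_poly_def)
  \<comment> \<open>The conjugate reciprocal of \<open>p\<close>, reflected at \<open>M\<close> and
    not at \<open>degree p\<close>, so that the same prefactor fits both polynomials.\<close>
  define q where "q = (\<Sum>i\<le>M. monom (cnj (coeff p i)) (M - i))"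
  have "degree q \<le> M" unfolding q_def
    by (intro degree_sum_le) (auto intro: order_trans[OF degree_monom_le])
  have cnj: "cnj (f \<theta>) = cis (- (real M * \<theta> / 2)) * poly q (cis \<theta>)" for \<theta>
  proof -
    have "poly p (cis \<theta>) = (\<Sum>i\<le>M. coeff p i * cis \<theta> ^ i)"
      unfolding poly_altdef using p(1)
      by (intro sum.mono_neutral_left) (auto simp: coeff_eq_0)
    then have "cnj (f \<theta>) = (\<Sum>i\<le>M. cis (real M * \<theta> / 2) * (cnj (coeff p i) * cis (- (real i * \<theta>))))"
      by (simp add: p(2) cis_cnj sum_distrib_left Complex.DeMoivre)
    also have "\<dots> = (\<Sum>i\<le>M. cis (- (real M * \<theta> / 2)) * (cnj (coeff p i) * cis \<theta> ^ (M - i)))"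
    proof (intro sum.cong refl)
      fix i assume "i \<in> {..M}"
      then have "cis (real M * \<theta> / 2) * cis (- (real i * \<theta>)) = cis (- (real M * \<theta> / 2)) * cis \<theta> ^ (M - i)"
        by (simp add: cis_mult Complex.DeMoivre of_nat_diff) (simp add: field_simps)
      then show "cis (real M * \<theta> / 2) * (cnj (coeff p i) * cis (- (real i * \<theta>))) =
          cis (- (real M * \<theta> / 2)) * (cnj (coeff p i) * cis \<theta> ^ (M - i))"
        by (metis mult.left_commute)
    qed
    also have "\<dots> = cis (- (real M * \<theta> / 2)) * poly q (cis \<theta>)"
      by (simp add: q_def poly_sum poly_monom sum_distrib_left)
    finally show ?thesis .
  qed
  show ?thesis unfolding half_trig_poly_def
  proof (intro exI conjI allI)
    show "degree (smult (1/2) (p + q)) \<le> M"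
      using p(1) \<open>degree q \<le> M\<close> degree_add_le[of p M q] by (simp add: order_trans[OF degree_smult_le])
    fix \<theta>
    have Re: "of_real (Re (f \<theta>)) = (f \<theta> + cnj (f \<theta>)) / 2"
      by (simp add: complex_add_cnj)
    show "of_real (Re (f \<theta>)) = cis (- (real M * \<theta> / 2)) * poly (smult (1/2) (p + q)) (cis \<theta>)"
      unfolding Re cnj unfolding p(2) by (simp add: algebra_simps add_divide_distrib)
  qed
qed

lemma half_trig_poly_continuous:
  assumes "half_trig_poly M f" shows "continuous_on S f"
proof -
  obtain p where p: "f = (\<lambda>\<theta>. cis (- (real M * \<theta> / 2)) * poly p (cis \<theta>))"
    using assms by (auto simp: half_trig_poly_def)
  show ?thesis unfolding p
    by (intro continuous_intros continuous_on_poly continuous_on_cis) auto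
qed

lemma half_trig_poly_bounded:
  assumes "half_trig_poly M f" obtains B where "\<And>\<theta>. norm (f \<theta>) \<le> B"
proof -
  obtain p where p: "\<And>\<theta>. f \<theta> = cis (- (real M * \<theta> / 2)) * poly p (cis \<theta>)"
    using assms by (auto simp: half_trig_poly_def)
  have "norm (f \<theta>) \<le> (\<Sum>i\<le>degree p. norm (coeff p i))" for \<theta>
    unfolding p poly_altdef norm_mult norm_cis
    by (simp, intro sum_norm_le) (simp add: norm_mult norm_power)
  with that show ?thesis by blast
qed

section \<open>Sign changes of a real function on an interval\<close>

text \<open>If both signs fail, \<open>g\<close> takes a negative and a positive value. The
  intermediate zero differs from both points, hence lies strictly inside the interval even if one of
  them is an endpoint.\<close>

lemma constant_sign_interval:
  fixes g :: "real \<Rightarrow> real"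
  assumes cont: "continuous_on {a..b} g" and nz: "\<And>x. a < x \<Longrightarrow> x < b \<Longrightarrow> g x \<noteq> 0"
  shows "\<exists>s\<in>{1, -1}. \<forall>x\<in>{a..b}. 0 \<le> s * g x"
proof (rule ccontr)
  assume neg: "\<not> ?thesis"
  then obtain x where x: "x \<in> {a..b}" "g x < 0" by (auto simp: not_le)
  from neg obtain y where y: "y \<in> {a..b}" "g y > 0" by (auto simp: not_le)
  have "x \<noteq> y" using x y by auto
  then consider "x < y" | "y < x" by linarith
  then show False
  proof cases
    case 1
    have "continuous_on {x..y} g" using cont x y by (auto intro: continuous_on_subset)
    then obtain z where "x \<le> z" "z \<le> y" "g z = 0"
      using IVT'[of g x 0 y] x y 1 by auto
    moreover have "z \<noteq> x" "z \<noteq> y" using x y \<open>g z = 0\<close> by auto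
    ultimately show False using nz[of z] x y by auto
  next
    case 2
    have "continuous_on {y..x} g" using cont x y by (auto intro: continuous_on_subset)
    then obtain z where "y \<le> z" "z \<le> x" "g z = 0"
      using IVT2'[of g x 0 y] x y 2 by auto
    moreover have "z \<noteq> x" "z \<noteq> y" using x y \<open>g z = 0\<close> by auto
    ultimately show False using nz[of z] x y by auto
  qed
qed

text \<open>Induction on the number of zeros, splitting at the largest one, \<open>z\<close>. Left
  of \<open>z\<close> the induction hypothesis applies, right of it \<open>g\<close> has constant
  sign; a factor for \<open>z\<close> is added exactly when the two signs differ. The bound on
  \<open>b\<close> keeps every \<open>(x - c) / 2\<close> within \<open>-pi\<close> and
  \<open>pi\<close>, where the sine has the sign of \<open>x - c\<close>.\<close>

lemma sign_changes_cancel: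
  fixes g :: "real \<Rightarrow> real"
  assumes "finite {x. a < x \<and> x < b \<and> g x = 0}" "continuous_on {a..b} g" "b \<le> a + 2 * pi"
  shows "\<exists>A \<subseteq> {x. a < x \<and> x < b \<and> g x = 0}. \<exists>s\<in>{1, -1}.
           \<forall>x\<in>{a..b}. 0 \<le> s * g x * (\<Prod>c\<in>A. sin ((x - c) / 2))"
  using assms
proof (induction "card {x. a < x \<and> x < b \<and> g x = 0}" arbitrary: b rule: less_induct)
  case less
  let ?Z = "\<lambda>b. {x. a < x \<and> x < b \<and> g x = 0}"
  show ?case
  proof (cases "?Z b = {}")
    case True
    then have "\<exists>s\<in>{1, -1}. \<forall>x\<in>{a..b}. 0 \<le> s * g x"
      using less.prems by (intro constant_sign_interval) auto
    then show ?thesis by (intro exI[of _ "{}"]) auto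
  next
    case False
    define z where "z = Max (?Z b)"
    have z: "z \<in> ?Z b" unfolding z_def using less.prems(1) False by (rule Max_in)
    have zmax: "x \<le> z" if "x \<in> ?Z b" for x unfolding z_def using less.prems(1) that by (rule Max_ge)
    have sub: "?Z z \<subset> ?Z b" using z by auto
    have "\<exists>A \<subseteq> ?Z z. \<exists>s\<in>{1, -1}. \<forall>x\<in>{a..z}. 0 \<le> s * g x * (\<Prod>c\<in>A. sin ((x - c) / 2))"
    proof (rule less.hyps)
      show "card (?Z z) < card (?Z b)" using less.prems(1) sub by (rule psubset_card_mono)
      show "finite (?Z z)" using less.prems(1) sub finite_subset by blast
      show "continuous_on {a..z} g" using less.prems(2) z by (auto intro: continuous_on_subset)
      show "z \<le> a + 2 * pi" using z less.prems(3) by auto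
    qed
    then obtain A s where A: "A \<subseteq> ?Z z" "s \<in> {1, -1}"
      and s: "\<And>x. x \<in> {a..z} \<Longrightarrow> 0 \<le> s * g x * (\<Prod>c\<in>A. sin ((x - c) / 2))" by blast
    have "\<exists>s\<in>{1, -1}. \<forall>x\<in>{z..b}. 0 \<le> s * g x"
    proof (rule constant_sign_interval)
      show "continuous_on {z..b} g" using less.prems(2) z by (auto intro: continuous_on_subset)
      show "g x \<noteq> 0" if "z < x" "x < b" for x using zmax[of x] that z by auto
    qed
    then obtain s' where s': "s' \<in> {1, -1}" "\<And>x. x \<in> {z..b} \<Longrightarrow> 0 \<le> s' * g x" by blast
    \<comment> \<open>To the right of \<open>z\<close> no factor is negative, so there the sign of
      the product is governed by \<open>g\<close> alone.\<close>
    have sin_pos: "0 \<le> sin ((x - c) / 2)" if "x \<in> {z..b}" "c \<in> insert z A" for x c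
      using that z A(1) less.prems(3) by (intro sin_ge_zero) auto
    have finA: "finite A" "z \<notin> A" using A(1) less.prems(1) sub finite_subset[of A "?Z b"] by blast+
    show ?thesis
    proof (cases "s' = s")
      case True
      have "0 \<le> s * g x * (\<Prod>c\<in>A. sin ((x - c) / 2))" if "x \<in> {a..b}" for x
      proof (cases "x \<le> z")
        case False
        then show ?thesis using that True s'(2)[of x] sin_pos[of x]
          by (intro mult_nonneg_nonneg[of "s * g x"] prod_nonneg) auto
      qed (use s that in auto)
      moreover have "A \<subseteq> ?Z b" using A(1) sub by blast
      ultimately show ?thesis using A(2) by (intro exI[of _ A]) blast
    next
      case False
      then have s's: "s' = - s" using A(2) s'(1) by auto
      \<comment> \<open>The new factor is nonpositive left of \<open>z\<close>, which turns the sign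
        \<open>s\<close> into \<open>s' = - s\<close>, and nonnegative right of
        \<open>z\<close>.\<close>
      have "0 \<le> s' * g x * (\<Prod>c\<in>insert z A. sin ((x - c) / 2))" if x: "x \<in> {a..b}" for x
      proof (cases "x \<le> z")
        case True
        have "0 \<le> sin ((z - x) / 2)" using True x z less.prems(3) by (intro sin_ge_zero) auto
        also have "sin ((z - x) / 2) = - sin ((x - z) / 2)"
          by (metis minus_diff_eq minus_divide_left sin_minus)
        finally have "0 \<le> (s * g x * (\<Prod>c\<in>A. sin ((x - c) / 2))) * (- sin ((x - z) / 2))"
          using s[of x] True x by (intro mult_nonneg_nonneg[of "s * g x * _"]) auto
        then show ?thesis using finA by (simp add: s's algebra_simps)
      next
        case False
        then show ?thesis using that s'(2)[of x] sin_pos[of x]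
          by (intro mult_nonneg_nonneg[of "s' * g x"] prod_nonneg) auto
      qed
      moreover have "insert z A \<subseteq> ?Z b" using A(1) sub z by blast
      ultimately show ?thesis using s'(1) by (intro exI[of _ "insert z A"]) blast
    qed
  qed
qed

section \<open>The branch of the argument on the unit circle\<close>

lemma arg_from_eqI:
  assumes "norm z = 1" "t0 \<le> \<theta>" "\<theta> < t0 + 2 * pi" "cis \<theta> = z"
  shows "arg_from t0 z = \<theta>"
  unfolding arg_from_def using assms
  by (intro the_equality) (auto intro: cis_inj_interval)

text \<open>Rotation by \<open>- t0\<close> reduces the claim to \<open>Arg2pi\<close>, whose values
  start at 0.\<close>

lemma arg_from_circle:
  assumes "norm z = 1"
  shows "t0 \<le> arg_from t0 z" "arg_from t0 z < t0 + 2 * pi" "cis (arg_from t0 z) = z"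
proof -
  define w where "w = z * cis (- t0)"
  have "norm w = 1" using assms by (simp add: w_def norm_mult)
  then have "w = cis (Arg2pi w)" using Arg2pi_eq[of w] by (simp add: cis_conv_exp)
  then have "cis (t0 + Arg2pi w) = cis t0 * w" by (metis cis_mult)
  also have "\<dots> = z" by (simp add: w_def cis_mult mult.left_commute[of "cis t0"])
  finally have z: "cis (t0 + Arg2pi w) = z" .
  have "arg_from t0 z = t0 + Arg2pi w"
    using assms Arg2pi[of w] z by (intro arg_from_eqI) auto
  then show "t0 \<le> arg_from t0 z" "arg_from t0 z < t0 + 2 * pi" "cis (arg_from t0 z) = z"
    using Arg2pi[of w] z by auto
qed

lemma half_pow_circle:
  assumes "norm z = 1"
  shows "half_pow t0 m z = cis (of_int m * arg_from t0 z / 2)"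
proof -
  have "sqrt_from t0 z = cis (arg_from t0 z / 2)"
    using assms by (simp add: sqrt_from_def cis_conv_exp)
  then show ?thesis by (simp add: half_pow_def cis_power_int)
qed

section \<open>Measurability, supports and integrability on the circle\<close>

lemma circle_prob_space:
  assumes "circle_prob \<mu>" shows "space \<mu> = sphere 0 1"
  using assms sets_eq_imp_space_eq[of \<mu> "restrict_space borel (sphere 0 1)"]
  by (auto simp: circle_prob_def space_restrict_space)

lemma circle_prob_sets:
  assumes "circle_prob \<mu>" "S \<in> sets borel" "S \<subseteq> sphere 0 1" shows "S \<in> sets \<mu>"
proof -
  have "S = sphere 0 1 \<inter> S" using assms(3) by blast
  then show ?thesis using assms(1,2) unfolding circle_prob_def sets_restrict_space by blast
qed

text \<open>The argument jumps at \<open>cis t0\<close>, so continuity on the circle fails. Its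
  sublevel sets are nevertheless compact arcs (empty for \<open>x < t0\<close>) or the full
  circle.\<close>

lemma arg_from_measurable:
  assumes "circle_prob \<mu>" shows "arg_from t0 \<in> borel_measurable \<mu>"
proof (rule borel_measurableI_le)
  fix x
  have "{z \<in> space \<mu>. arg_from t0 z \<le> x} =
      (if x < t0 + 2 * pi then cis ` {t0..x} else sphere 0 1)" (is "?L = ?R")
  proof (cases "x < t0 + 2 * pi")
    case True
    have "z \<in> ?L \<longleftrightarrow> z \<in> cis ` {t0..x}" for z
    proof
      assume "z \<in> ?L"
      then show "z \<in> cis ` {t0..x}"
        using arg_from_circle[of z t0] circle_prob_space[OF assms]
        by (intro image_eqI[of _ _ "arg_from t0 z"]) auto
    next
      assume "z \<in> cis ` {t0..x}"
      then obtain \<theta> where "z = cis \<theta>" "t0 \<le> \<theta>" "\<theta> \<le> x" by auto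
      moreover from this have "arg_from t0 z = \<theta>" using True by (intro arg_from_eqI) auto
      ultimately show "z \<in> ?L" using circle_prob_space[OF assms] by auto
    qed
    then show ?thesis using True by auto
  next
    case False
    have "arg_from t0 z \<le> x" if "z \<in> sphere 0 1" for z
      using that False arg_from_circle(2)[of z t0] by simp
    then show ?thesis using False circle_prob_space[OF assms] by auto
  qed
  moreover have "cis ` {t0..x} \<in> sets borel"
    by (intro borel_closed compact_imp_closed compact_continuous_image continuous_on_cis continuous_on_id compact_Icc)
  then have "cis ` {t0..x} \<in> sets \<mu>" by (rule circle_prob_sets[OF assms]) auto
  moreover have "sphere 0 1 \<in> sets \<mu>" using sets.top[of \<mu>] circle_prob_space[OF assms] by simp
  ultimately show "{z \<in> space \<mu>. arg_from t0 z \<le> x} \<in> sets \<mu>" by simp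
qed

text \<open>The complement of the support in the circle is covered by open sets whose traces are
  null. By Lindelof's theorem countably many of them suffice, so their union is null.\<close>

lemma AE_circle_supp:
  assumes "circle_prob \<mu>" shows "AE z in \<mu>. z \<in> circle_supp \<mu>"
proof -
  interpret prob_space \<mu> using assms by (simp add: circle_prob_def)
  define \<U> where "\<U> = {U. open U \<and> measure \<mu> (U \<inter> sphere 0 1) = 0}"
  have "\<And>U. U \<in> \<U> \<Longrightarrow> open U" by (auto simp: \<U>_def)
  then obtain \<V> where \<V>: "\<V> \<subseteq> \<U>" "countable \<V>" "\<Union>\<V> = \<Union>\<U>" by (rule Lindelof)
  have "AE z in \<mu>. z \<notin> U" if "U \<in> \<V>" for U
  proof -
    have U: "open U" "measure \<mu> (U \<inter> sphere 0 1) = 0" using that \<V> by (auto simp: \<U>_def)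
    have "U \<inter> sphere 0 1 \<in> sets \<mu>"
      using U by (intro circle_prob_sets[OF assms] sets.Int borel_open borel_closed closed_sphere) auto
    then have "U \<inter> sphere 0 1 \<in> null_sets \<mu>" using U by (auto simp: emeasure_eq_measure)
    then have "AE z in \<mu>. z \<notin> U \<inter> sphere 0 1" by (rule AE_not_in)
    with AE_space show ?thesis by eventually_elim (auto simp: circle_prob_space[OF assms])
  qed
  then have "AE z in \<mu>. \<forall>U\<in>\<V>. z \<notin> U" using \<V>(2) by (simp add: AE_ball_countable)
  with AE_space show ?thesis
  proof eventually_elim
    case (elim z)
    then have "z \<notin> \<Union>\<U>" using \<V>(3) by auto
    then show ?case using elim circle_prob_space[OF assms]
      by (auto simp: circle_supp_def \<U>_def zero_less_measure_iff)
  qed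
qed

text \<open>The complement of \<open>F\<close> is open with null trace on the circle, so it contains
  no support point. Applied to a finite \<open>F\<close>, this contradicts infinite support.\<close>

lemma circle_supp_subset_closed:
  assumes "circle_prob \<mu>" "closed F" "AE z in \<mu>. z \<in> F"
  shows "circle_supp \<mu> \<subseteq> F"
proof (rule ccontr)
  interpret prob_space \<mu> using assms by (simp add: circle_prob_def)
  assume "\<not> circle_supp \<mu> \<subseteq> F"
  then obtain z where z: "z \<in> circle_supp \<mu>" "z \<in> - F" by auto
  then have "0 < measure \<mu> (- F \<inter> sphere 0 1)"
    using assms(2) by (auto simp: circle_supp_def open_Compl)
  moreover have "- F \<inter> sphere 0 1 \<in> sets \<mu>"
    using assms(2) by (intro circle_prob_sets[OF assms(1)] sets.Int borel_open borel_closed open_Compl closed_sphere) auto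
  then have "emeasure \<mu> (- F \<inter> sphere 0 1) = 0"
    using AE_iff_measurable[of "- F \<inter> sphere 0 1" \<mu> "\<lambda>z. z \<in> F"] assms(3)
    by (simp add: circle_prob_space[OF assms(1)] Int_def conj_commute)
  ultimately show False by (simp add: emeasure_eq_measure)
qed

lemma half_trig_poly_measurable:
  assumes "circle_prob \<mu>" "half_trig_poly M f"
  shows "(\<lambda>z. f (arg_from t0 z)) \<in> borel_measurable \<mu>"
  using borel_measurable_continuous_onI[OF half_trig_poly_continuous[OF assms(2)]]
    arg_from_measurable[OF assms(1)] by (rule measurable_compose_rev)

lemma half_trig_poly_integrable:
  assumes "circle_prob \<mu>" "half_trig_poly M f"
  shows "integrable \<mu> (\<lambda>z. f (arg_from t0 z))"
proof -
  interpret prob_space \<mu> using assms by (simp add: circle_prob_def)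
  obtain B where "\<And>\<theta>. norm (f \<theta>) \<le> B" using assms(2) half_trig_poly_bounded by blast
  then show ?thesis
    using half_trig_poly_measurable[OF assms] by (intro integrable_const_bound[of _ B]) auto
qed

section \<open>Zeros forced by orthogonality on one arc\<close>

text \<open>With too few zeros, some admissible \<open>f\<close> makes \<open>g * f\<close> of one
  sign on the arc. Its integral is 0, so it vanishes almost everywhere; having finitely many zeros
  per period, it confines the support to a finite set.\<close>

lemma zeros_in_arc:
  fixes g :: "real \<Rightarrow> real"
  assumes \<mu>: "circle_prob \<mu>" "infinite (circle_supp \<mu>)"
    and arc: "AE z in \<mu>. arg_from t0 z \<in> {a..b}" "t0 \<le> a" "a \<le> b" "b \<le> t0 + 2 * pi"
    and g: "half_trig_poly M (\<lambda>\<theta>. of_real (g \<theta>))" "g \<theta>' \<noteq> 0"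
    and orth: "\<And>f. half_trig_poly (n - 1) (\<lambda>\<theta>. of_real (f \<theta>)) \<Longrightarrow>
       (\<integral>z. g (arg_from t0 z) * f (arg_from t0 z) \<partial>\<mu>) = 0"
  shows "n \<le> card {x. a < x \<and> x < b \<and> g x = 0}" (is "n \<le> card ?Z")
proof (rule ccontr)
  assume less: "\<not> n \<le> card ?Z"
  have "?Z \<subseteq> {x. t0 \<le> x \<and> x < t0 + 2 * pi \<and> of_real (g x) = (0::complex)}"
    using arc by auto
  then have finZ: "finite ?Z"
    using half_trig_poly_zeros(1)[OF g(1), of \<theta>' t0] g(2) finite_subset by auto
  have "continuous_on {a..b} (\<lambda>x. Re (of_real (g x)))"
    by (intro continuous_on_Re half_trig_poly_continuous[OF g(1)])
  then have "continuous_on {a..b} g" by simp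
  moreover have "b \<le> a + 2 * pi" using arc(2,4) by simp
  ultimately obtain A s where A: "A \<subseteq> ?Z" "s \<in> {1, -1}"
    and s: "\<And>x. x \<in> {a..b} \<Longrightarrow> 0 \<le> s * g x * (\<Prod>c\<in>A. sin ((x - c) / 2))"
    using sign_changes_cancel[OF finZ] by blast
  have finA: "finite A" using A(1) finZ by (rule finite_subset)
  \<comment> \<open>The assumption \<open>less\<close> excludes \<open>n = 0\<close>, so
    \<open>n - 1\<close> is a genuine predecessor.\<close>
  have "card A \<le> n - 1" using less card_mono[OF finZ A(1)] by simp
  then obtain k where k: "n - 1 = card A + k" using le_Suc_ex by blast
  \<comment> \<open>The missing zeros are put at the endpoint \<open>a\<close>: this gives \<open>f\<close> the exact order \<open>n - 1\<close>
    (hence the right parity) without adding sign changes on the arc.\<close>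
  define f where "f x = (\<Prod>c\<in>A. sin ((x - c) / 2)) * sin ((x - a) / 2) ^ k" for x
  have f: "half_trig_poly (n - 1) (\<lambda>\<theta>. of_real (f \<theta>))"
    using half_trig_poly_mult[OF half_trig_poly_prod_sin[OF finA] half_trig_poly_sin_power[of k a]]
    unfolding k by (simp add: f_def)
  have gf: "half_trig_poly (M + (n - 1)) (\<lambda>\<theta>. of_real (g \<theta> * f \<theta>))"
    using half_trig_poly_mult[OF g(1) f] by simp
  have sgf: "0 \<le> s * (g x * f x)" if "x \<in> {a..b}" for x
  proof -
    have "0 \<le> sin ((x - a) / 2)" using that arc by (intro sin_ge_zero) auto
    then have "0 \<le> s * g x * (\<Prod>c\<in>A. sin ((x - c) / 2)) * sin ((x - a) / 2) ^ k"
      using s[OF that] by (intro mult_nonneg_nonneg[of "s * g x * _"]) auto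
    then show ?thesis by (simp add: f_def mult.assoc)
  qed
  have "integrable \<mu> (\<lambda>z. Re (of_real (g (arg_from t0 z) * f (arg_from t0 z))))"
    using half_trig_poly_integrable[OF \<mu>(1) gf] by (rule integrable_Re)
  then have int: "integrable \<mu> (\<lambda>z. s * (g (arg_from t0 z) * f (arg_from t0 z)))" by simp
  have "(\<integral>z. s * (g (arg_from t0 z) * f (arg_from t0 z)) \<partial>\<mu>) = 0"
    using orth[OF f] by simp
  moreover have "AE z in \<mu>. 0 \<le> s * (g (arg_from t0 z) * f (arg_from t0 z))"
    using arc(1) by eventually_elim (rule sgf)
  ultimately have "AE z in \<mu>. s * (g (arg_from t0 z) * f (arg_from t0 z)) = 0"
    using integral_nonneg_eq_0_iff_AE[OF int] by blast
  then have ae0: "AE z in \<mu>. g (arg_from t0 z) * f (arg_from t0 z) = 0" using A(2) by auto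
  \<comment> \<open>The zero bound for \<open>g * f\<close> requires a point where it is nonzero.
    Choosing \<open>y\<close> strictly inside the period, away from the zeros of \<open>g\<close>
    and from \<open>insert a A\<close>, gives \<open>\<bar>y - c\<bar> < 2 * pi\<close>, so no sine
    factor vanishes.\<close>
  obtain y where "g y * f y \<noteq> 0"
  proof -
    have inf: "infinite {t0<..<t0 + 2 * pi}" using pi_gt_zero by (simp add: infinite_Ioo)
    let ?W = "{x. t0 \<le> x \<and> x < t0 + 2 * pi \<and> of_real (g x) = (0::complex)}"
    have "finite (?W \<union> insert a A)"
      using half_trig_poly_zeros(1)[OF g(1), of \<theta>' t0] g(2) finA by simp
    then obtain y where y: "y \<in> {t0<..<t0 + 2 * pi}" "y \<notin> ?W \<union> insert a A"
      using inf by (meson finite_subset subsetI)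
    have "sin ((y - c) / 2) \<noteq> 0" if "c \<in> insert a A" for c
    proof -
      have "y \<noteq> c" "\<bar>y - c\<bar> < 2 * pi" using y that A(1) arc(2-4) by auto
      then show ?thesis using sin_gt_zero[of "(y - c) / 2"] sin_gt_zero[of "(c - y) / 2"]
        sin_minus[of "(y - c) / 2"] by (cases "y < c") (auto simp: minus_divide_left)
    qed
    then have "f y \<noteq> 0" using finA by (simp add: f_def)
    moreover have "g y \<noteq> 0" using y by auto
    ultimately show ?thesis using that by simp
  qed
  define F where "F = {x. t0 \<le> x \<and> x < t0 + 2 * pi \<and> of_real (g x * f x) = (0::complex)}"
  have "finite F" unfolding F_def
    using \<open>g y * f y \<noteq> 0\<close> by (intro half_trig_poly_zeros(1)[OF gf, of y]) simp
  have "circle_supp \<mu> \<subseteq> cis ` F"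
  proof (rule circle_supp_subset_closed[OF \<mu>(1)])
    show "closed (cis ` F)" using \<open>finite F\<close> by (intro finite_imp_closed) auto
    show "AE z in \<mu>. z \<in> cis ` F"
      using ae0 AE_space
    proof eventually_elim
      case (elim z)
      then have "norm z = 1" by (simp add: circle_prob_space[OF \<mu>(1)])
      with elim show ?case using arg_from_circle[of z t0]
        by (intro image_eqI[of _ _ "arg_from t0 z"]) (auto simp: F_def)
    qed
  qed
  then show False using \<mu>(2) \<open>finite F\<close> finite_subset by blast
qed

section \<open>From single exponentials to their span\<close>

text \<open>Exponents are listed from the top down, matching the index \<open>l\<close> of the
  orthogonality conditions.\<close>

lemma half_trig_poly_expansion:
  assumes "half_trig_poly m f"
  obtains c where "\<And>\<theta>. f \<theta> = (\<Sum>i\<le>m. c i * cis ((real m - 2 * real i) * \<theta> / 2))"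
proof -
  obtain p where p: "degree p \<le> m" "\<And>\<theta>. f \<theta> = cis (- (real m * \<theta> / 2)) * poly p (cis \<theta>)"
    using assms by (auto simp: half_trig_poly_def)
  have "f \<theta> = (\<Sum>i\<le>m. coeff p (m - i) * cis ((real m - 2 * real i) * \<theta> / 2))" for \<theta>
  proof -
    have "poly p (cis \<theta>) = (\<Sum>i\<le>m. coeff p i * cis \<theta> ^ i)"
      unfolding poly_altdef using p(1)
      by (intro sum.mono_neutral_left) (auto simp: coeff_eq_0)
    also have "\<dots> = (\<Sum>i\<le>m. coeff p (m - i) * cis \<theta> ^ (m - i))"
      by (rule sum.reindex_bij_witness[of _ "\<lambda>i. m - i" "\<lambda>i. m - i"]) auto
    finally have "f \<theta> = (\<Sum>i\<le>m. coeff p (m - i) * (cis (- (real m * \<theta> / 2)) * cis \<theta> ^ (m - i)))"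
      by (simp add: p(2) sum_distrib_left mult.left_commute)
    also have "\<dots> = (\<Sum>i\<le>m. coeff p (m - i) * cis ((real m - 2 * real i) * \<theta> / 2))"
    proof (intro sum.cong refl arg_cong2[where f = "(*)"])
      fix i assume "i \<in> {..m}"
      then have "- (real m * \<theta> / 2) + real (m - i) * \<theta> = (real m - 2 * real i) * \<theta> / 2"
        by (simp add: of_nat_diff field_simps)
      then show "cis (- (real m * \<theta> / 2)) * cis \<theta> ^ (m - i) = cis ((real m - 2 * real i) * \<theta> / 2)"
        by (simp only: Complex.DeMoivre cis_mult)
    qed
    finally show ?thesis .
  qed
  then show ?thesis by (rule that)
qed

lemma half_trig_poly_cis:
  assumes "i \<le> m"
  shows "half_trig_poly m (\<lambda>\<theta>. cis ((real m - 2 * real i) * \<theta> / 2))"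
  unfolding half_trig_poly_def
proof (intro exI conjI allI)
  show "degree (monom 1 (m - i)) \<le> m" by (rule order_trans[OF degree_monom_le]) simp
  fix \<theta>
  have "- (real m * \<theta> / 2) + real (m - i) * \<theta> = (real m - 2 * real i) * \<theta> / 2"
    using assms by (simp add: of_nat_diff field_simps)
  then show "cis ((real m - 2 * real i) * \<theta> / 2) =
      cis (- (real m * \<theta> / 2)) * poly (monom 1 (m - i)) (cis \<theta>)"
    by (simp only: poly_monom mult_1 Complex.DeMoivre cis_mult)
qed

lemma orthogonal_half_trig_poly:
  assumes \<mu>: "circle_prob \<mu>" and \<psi>: "half_trig_poly M \<psi>" and f: "half_trig_poly m f"
    and orth: "\<And>l. l \<le> m \<Longrightarrow>
      (\<integral>z. \<psi> (arg_from t0 z) * cis ((real m - 2 * real l) * arg_from t0 z / 2) \<partial>\<mu>) = 0"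
  shows "(\<integral>z. \<psi> (arg_from t0 z) * f (arg_from t0 z) \<partial>\<mu>) = 0"
proof -
  obtain c where c: "\<And>\<theta>. f \<theta> = (\<Sum>i\<le>m. c i * cis ((real m - 2 * real i) * \<theta> / 2))"
    using half_trig_poly_expansion[OF f] by blast
  have int: "integrable \<mu> (\<lambda>z. \<psi> (arg_from t0 z) * cis ((real m - 2 * real l) * arg_from t0 z / 2))"
    if "l \<le> m" for l
    using half_trig_poly_integrable[OF \<mu> half_trig_poly_mult[OF \<psi> half_trig_poly_cis[OF that]]] .
  have "(\<integral>z. \<psi> (arg_from t0 z) * f (arg_from t0 z) \<partial>\<mu>) =
      (\<integral>z. (\<Sum>i\<le>m. c i * (\<psi> (arg_from t0 z) * cis ((real m - 2 * real i) * arg_from t0 z / 2))) \<partial>\<mu>)"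
    by (simp add: c sum_distrib_left mult.left_commute)
  also have "\<dots> = (\<Sum>i\<le>m. c i * (\<integral>z. \<psi> (arg_from t0 z) * cis ((real m - 2 * real i) * arg_from t0 z / 2) \<partial>\<mu>))"
    using int by (subst Bochner_Integration.integral_sum) auto
  also have "\<dots> = 0" using orth by simp
  finally show ?thesis .
qed

lemma half_pow_mult_integrable:
  assumes "circle_prob \<mu>"
  shows "integrable \<mu> (\<lambda>z. half_pow t0 a z * half_pow t0 b z)"
proof -
  interpret prob_space \<mu> using assms by (simp add: circle_prob_def)
  let ?h = "\<lambda>x. cis (of_int a * x / 2) * cis (of_int b * x / 2)"
  have "?h \<in> borel_measurable borel"
    by (intro borel_measurable_continuous_onI continuous_intros continuous_on_cis) auto
  then have "(\<lambda>z. ?h (arg_from t0 z)) \<in> borel_measurable \<mu>"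
    using arg_from_measurable[OF assms] by (rule measurable_compose_rev)
  then have "integrable \<mu> (\<lambda>z. ?h (arg_from t0 z))"
    by (intro integrable_const_bound[of _ 1]) (auto simp: norm_mult)
  moreover have "half_pow t0 a z * half_pow t0 b z = ?h (arg_from t0 z)" if "z \<in> space \<mu>" for z
    using that by (simp add: half_pow_circle circle_prob_space[OF assms])
  ultimately show ?thesis by (subst Bochner_Integration.integrable_cong[OF refl])
qed

lemma integral_half_pow_sum:
  assumes "circle_prob \<mu>"
  shows "(\<integral>z. (\<Sum>i\<in>L. x i * half_pow t0 (k i) z) * half_pow t0 b z \<partial>\<mu>) =
    (\<Sum>i\<in>L. x i * (\<integral>z. half_pow t0 (k i) z * half_pow t0 b z \<partial>\<mu>))"
  using half_pow_mult_integrable[OF assms]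
  by (simp add: sum_distrib_right mult.assoc Bochner_Integration.integral_sum)

section \<open>Arcs as intervals of the argument\<close>

text \<open>An angle of the parametrised arc equals the value of \<open>arg_from t0\<close> except
  at \<open>t0 + 2 * pi\<close>, where the branch returns \<open>t0\<close>. The proof shows that
  this angle can be ignored up to null sets.\<close>

lemma ordered_arcs_AE:
  assumes sys: "angelesco_system r \<mu> \<Gamma>" and ord: "ordered_arcs t0 r \<Gamma>"
    and atom: "measure (\<mu> r) {cis t0} = 0"
  obtains \<alpha> \<beta> where
    "\<And>j. j \<in> {1..r} \<Longrightarrow> AE z in \<mu> j. arg_from t0 z \<in> {\<alpha> j..\<beta> j}"
    "\<And>j. j \<in> {1..r} \<Longrightarrow> \<alpha> j \<le> \<beta> j"
    "\<And>j. j \<in> {1..r} \<Longrightarrow> t0 \<le> \<alpha> j" "\<And>j. j \<in> {1..r} \<Longrightarrow> \<beta> j \<le> t0 + 2 * pi"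
    "\<And>j k. j \<in> {1..r} \<Longrightarrow> k \<in> {1..r} \<Longrightarrow> j < k \<Longrightarrow> \<beta> j \<le> \<alpha> k"
proof -
  obtain \<alpha> \<beta> where arc: "\<And>j. j \<in> {1..r} \<Longrightarrow> \<Gamma> j = arc_set (\<alpha> j) (\<beta> j)"
    and le: "\<And>j. j \<in> {1..r} \<Longrightarrow> \<alpha> j \<le> \<beta> j"
    and t0: "t0 \<le> \<alpha> 1" and step: "\<And>j. j \<in> {1..<r} \<Longrightarrow> \<beta> j \<le> \<alpha> (Suc j)"
    and top: "\<beta> r \<le> t0 + 2 * pi"
    using ord unfolding ordered_arcs_def by blast
  have order: "\<beta> j \<le> \<alpha> k" if "1 \<le> j" "j < k" "k \<le> r" for j k
  proof -
    have "Suc j \<le> k" using that by simp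
    then show ?thesis using that
    proof (induction k rule: dec_induct)
      case base
      then show ?case using step[of j] by simp
    next
      case (step k)
      then have "\<beta> j \<le> \<alpha> k" by simp
      also have "\<dots> \<le> \<beta> k" using le step by simp
      also have "\<dots> \<le> \<alpha> (Suc k)" using \<open>\<And>j. j \<in> {1..<r} \<Longrightarrow> \<beta> j \<le> \<alpha> (Suc j)\<close>[of k] step by simp
      finally show ?case .
    qed
  qed
  have lo: "t0 \<le> \<alpha> j" if "j \<in> {1..r}" for j
    using t0 le[of 1] order[of 1 j] that by (cases "j = 1") auto
  have hi: "\<beta> j \<le> t0 + 2 * pi" if "j \<in> {1..r}" for j
    using top order[of j r] le[of r] that by (cases "j = r") auto
  have prob: "circle_prob (\<mu> j)" and inf: "infinite (circle_supp (\<mu> j))"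
    and supp: "circle_supp (\<mu> j) \<subseteq> \<Gamma> j" if "j \<in> {1..r}" for j
    using sys that by (auto simp: angelesco_system_def)
  \<comment> \<open>A degenerate arc is a single point and cannot carry an infinite support. The
    strictness is used for the last arc, to keep the earlier ones away from
    \<open>t0 + 2 * pi\<close>.\<close>
  have lt: "\<alpha> j < \<beta> j" if "j \<in> {1..r}" for j
  proof (rule ccontr)
    assume "\<not> \<alpha> j < \<beta> j"
    then have "\<alpha> j = \<beta> j" using le[OF that] by simp
    then have "finite (\<Gamma> j)" using arc[OF that] by (simp add: arc_set_def)
    then show False using inf[OF that] supp[OF that] finite_subset by blast
  qed
  have "AE z in \<mu> j. arg_from t0 z \<in> {\<alpha> j..\<beta> j}" if j: "j \<in> {1..r}" for j
  proof -
    interpret prob_space "\<mu> j" using prob[OF j] by (simp add: circle_prob_def)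
    have "AE z in \<mu> j. z \<noteq> cis t0 \<or> j \<noteq> r"
    proof (cases "j = r")
      case True
      have "{cis t0} \<in> null_sets (\<mu> j)"
        using atom True circle_prob_sets[OF prob[OF j], of "{cis t0}"]
        by (intro null_setsI) (simp_all add: emeasure_eq_measure[of "{cis t0}", unfolded True])
      then have "AE z in \<mu> j. z \<notin> {cis t0}" by (rule AE_not_in)
      then show ?thesis by eventually_elim simp
    qed auto
    with AE_circle_supp[OF prob[OF j]] show ?thesis
    proof eventually_elim
      case (elim z)
      then obtain \<theta> where \<theta>: "z = cis \<theta>" "\<alpha> j \<le> \<theta>" "\<theta> \<le> \<beta> j"
        using supp[OF j] arc[OF j] by (auto simp: arc_set_def)
      \<comment> \<open>For \<open>j = r\<close> the point \<open>cis t0\<close> has been discarded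
        as a null set; for \<open>j < r\<close> the chain
        \<open>\<beta> j \<le> \<alpha> r < \<beta> r \<le> t0 + 2 * pi\<close> rules the angle
        out.\<close>
      have "\<theta> \<noteq> t0 + 2 * pi"
      proof
        assume *: "\<theta> = t0 + 2 * pi"
        then have "z = cis t0" using \<theta> by (simp add: cis_mult[symmetric])
        with elim have "j < r" using j by auto
        then have "\<beta> j \<le> \<alpha> r" using order[of j r] j by simp
        then show False using * \<theta> lt[of r] top j by auto
      qed
      then have "arg_from t0 z = \<theta>"
        using \<theta> lo[OF j] hi[OF j] by (intro arg_from_eqI) auto
      then show ?case using \<theta> by simp
    qed
  qed
  then show ?thesis using le lo hi order that[of \<alpha> \<beta>] by auto
qed

section \<open>Counting zeros over all arcs\<close>

text \<open>Serves both halves of normality: for uniqueness \<open>x\<close> is a difference of two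
  normalised solutions, for existence it shows that a nontrivial solution has a nonzero leading
  coefficient. The condition \<open>x 0 = 0\<close> lowers the order to \<open>N - 1\<close>, one
  less than the number of zeros forced.\<close>

lemma homogeneous_trivial:
  fixes x :: "nat \<Rightarrow> complex"
  assumes sys: "angelesco_system r \<mu> \<Gamma>" and ord: "ordered_arcs t0 r \<Gamma>"
    and atom: "measure (\<mu> r) {cis t0} = 0"
    and N: "N = index_size r n"
    and orth: "\<And>j l. j \<in> {1..r} \<Longrightarrow> l < n j \<Longrightarrow>
      (\<integral>z. (\<Sum>i\<le>N. x i * half_pow t0 (int N - 2 * int i) z)
            * half_pow t0 (int (n j) - 2 * int l) z \<partial>\<mu> j) = 0"
    and x0: "x 0 = 0" and i: "i \<le> N"
  shows "x i = 0"
\<comment> \<open>Since subtraction is truncated, the final contradiction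
  \<open>N \<le> N - 1\<close> is available only for positive \<open>N\<close>.\<close>
proof (cases "N = 0")
  case True
  then show ?thesis using x0 i by simp
next
  case False
  obtain \<alpha> \<beta> where ae: "\<And>j. j \<in> {1..r} \<Longrightarrow> AE z in \<mu> j. arg_from t0 z \<in> {\<alpha> j..\<beta> j}"
    and le: "\<And>j. j \<in> {1..r} \<Longrightarrow> \<alpha> j \<le> \<beta> j"
    and lo: "\<And>j. j \<in> {1..r} \<Longrightarrow> t0 \<le> \<alpha> j" and hi: "\<And>j. j \<in> {1..r} \<Longrightarrow> \<beta> j \<le> t0 + 2 * pi"
    and order: "\<And>j k. j \<in> {1..r} \<Longrightarrow> k \<in> {1..r} \<Longrightarrow> j < k \<Longrightarrow> \<beta> j \<le> \<alpha> k"
    using ordered_arcs_AE[OF sys ord atom] by blast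
  have prob: "circle_prob (\<mu> j)" and inf: "infinite (circle_supp (\<mu> j))" if "j \<in> {1..r}" for j
    using sys that by (auto simp: angelesco_system_def)
  \<comment> \<open>Index 0 is left out because \<open>x 0 = 0\<close>, which gives degree at most
    \<open>N - 1\<close>. On the circle \<open>\<psi>\<close> is the candidate function times the
    square root of \<open>z\<close>.\<close>
  define p where "p = (\<Sum>i=1..N. monom (x i) (N - i))"
  define \<psi> where "\<psi> \<theta> = cis (- (real (N - 1) * \<theta> / 2)) * poly p (cis \<theta>)" for \<theta>
  have "degree p \<le> N - 1" unfolding p_def
    by (intro degree_sum_le) (auto intro!: order_trans[OF degree_monom_le])
  then have \<psi>: "half_trig_poly (N - 1) \<psi>" by (auto simp: half_trig_poly_def \<psi>_def)
  \<comment> \<open>A factor \<open>z\<close> to the power \<open>1/2\<close> moved from the test function to \<open>\<phi>\<close> makes both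
    spans of exponents symmetric about \<open>0\<close>, hence closed under complex conjugation.\<close>
  have \<psi>_eq: "(\<Sum>i\<le>N. x i * half_pow t0 (int N - 2 * int i) z) * half_pow t0 (int m - 2 * int l) z
      = \<psi> (arg_from t0 z) * cis ((real (m - 1) - 2 * real l) * arg_from t0 z / 2)"
    if "norm z = 1" "l < m" for z l m
  proof -
    let ?\<theta> = "arg_from t0 z"
    have "(\<Sum>i\<le>N. x i * half_pow t0 (int N - 2 * int i) z) =
        (\<Sum>i=1..N. x i * cis (of_int (int N - 2 * int i) * ?\<theta> / 2))"
      using x0 by (simp add: half_pow_circle[OF that(1)] sum.atMost_shift sum.atLeast1_atMost_eq)
    also have "\<dots> = (\<Sum>i=1..N. cis (- (?\<theta> / 2)) *
        (cis (- (real (N - 1) * ?\<theta> / 2)) * (x i * cis ?\<theta> ^ (N - i))))"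
    proof (intro sum.cong refl)
      fix i assume "i \<in> {1..N}"
      then have "of_int (int N - 2 * int i) * ?\<theta> / 2 = - (?\<theta> / 2) + (- (real (N - 1) * ?\<theta> / 2) + real (N - i) * ?\<theta>)"
        by (simp add: of_nat_diff field_simps)
      then have "cis (of_int (int N - 2 * int i) * ?\<theta> / 2) =
          cis (- (?\<theta> / 2)) * (cis (- (real (N - 1) * ?\<theta> / 2)) * cis ?\<theta> ^ (N - i))"
        by (simp only: Complex.DeMoivre cis_mult)
      then show "x i * cis (of_int (int N - 2 * int i) * ?\<theta> / 2) = cis (- (?\<theta> / 2)) *
        (cis (- (real (N - 1) * ?\<theta> / 2)) * (x i * cis ?\<theta> ^ (N - i)))"
        by (simp only: mult_ac)
    qed
    also have "\<dots> = cis (- (?\<theta> / 2)) * \<psi> ?\<theta>"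
      by (simp add: \<psi>_def p_def poly_sum poly_monom sum_distrib_left)
    finally have 1: "(\<Sum>i\<le>N. x i * half_pow t0 (int N - 2 * int i) z) = cis (- (?\<theta> / 2)) * \<psi> ?\<theta>" .
    have "- (?\<theta> / 2) + of_int (int m - 2 * int l) * ?\<theta> / 2 = (real (m - 1) - 2 * real l) * ?\<theta> / 2"
      using that(2) by (simp add: of_nat_diff field_simps)
    then have "cis (- (?\<theta> / 2)) * half_pow t0 (int m - 2 * int l) z = cis ((real (m - 1) - 2 * real l) * ?\<theta> / 2)"
      by (simp only: half_pow_circle[OF that(1)] cis_mult)
    moreover have "cis (- (?\<theta> / 2)) * \<psi> ?\<theta> * h = \<psi> ?\<theta> * (cis (- (?\<theta> / 2)) * h)" for h
      by (simp only: mult_ac)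
    ultimately show ?thesis unfolding 1 by simp
  qed
  have orth_\<psi>: "(\<integral>z. \<psi> (arg_from t0 z) * f (arg_from t0 z) \<partial>\<mu> j) = 0"
    if j: "j \<in> {1..r}" "n j \<noteq> 0" and f: "half_trig_poly (n j - 1) f" for j f
  proof (rule orthogonal_half_trig_poly[OF prob[OF j(1)] \<psi> f])
    fix l assume "l \<le> n j - 1"
    then have l: "l < n j" using j(2) by simp
    have "(\<integral>z. \<psi> (arg_from t0 z) * cis ((real (n j - 1) - 2 * real l) * arg_from t0 z / 2) \<partial>\<mu> j) =
      (\<integral>z. (\<Sum>i\<le>N. x i * half_pow t0 (int N - 2 * int i) z)
            * half_pow t0 (int (n j) - 2 * int l) z \<partial>\<mu> j)"
      using l by (intro Bochner_Integration.integral_cong refl \<psi>_eq[symmetric])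
        (auto simp: circle_prob_space[OF prob[OF j(1)]])
    also have "\<dots> = 0" using orth[OF j(1) l] .
    finally show "(\<integral>z. \<psi> (arg_from t0 z) * cis ((real (n j - 1) - 2 * real l) * arg_from t0 z / 2) \<partial>\<mu> j) = 0" .
  qed
  \<comment> \<open>Sign arguments need real functions; the free factor \<open>c\<close> lets
    \<open>c = 1\<close> and \<open>c = \<i>\<close> recover both the real and the imaginary part of
    \<open>\<psi>\<close>.\<close>
  have Re0: "Re (c * \<psi> \<theta>') = 0" for c \<theta>'
  proof (rule ccontr)
    define g where "g \<theta> = Re (c * \<psi> \<theta>)" for \<theta>
    assume "Re (c * \<psi> \<theta>') \<noteq> 0"
    then have nz: "g \<theta>' \<noteq> 0" by (simp add: g_def)
    have g: "half_trig_poly (N - 1) (\<lambda>\<theta>. of_real (g \<theta>))"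
      unfolding g_def by (intro half_trig_poly_Re half_trig_poly_cmult \<psi>)
    \<comment> \<open>Only zeros in the open interval are counted, so that arcs sharing an endpoint
      contribute disjoint sets.\<close>
    define Z where "Z j = {\<theta>. \<alpha> j < \<theta> \<and> \<theta> < \<beta> j \<and> g \<theta> = 0}" for j
    define W where "W = {\<theta>. t0 \<le> \<theta> \<and> \<theta> < t0 + 2 * pi \<and> of_real (g \<theta>) = (0::complex)}"
    have W: "finite W" "card W \<le> N - 1"
      unfolding W_def using half_trig_poly_zeros[OF g, of \<theta>' t0] nz by auto
    have ZW: "Z j \<subseteq> W" if "j \<in> {1..r}" for j
      using lo[OF that] hi[OF that] by (auto simp: Z_def W_def)
    have "n j \<le> card (Z j)" if j: "j \<in> {1..r}" for j
    proof (cases "n j = 0")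
      case False
      show ?thesis unfolding Z_def
      proof (rule zeros_in_arc[OF prob[OF j] inf[OF j] ae[OF j] lo[OF j] le[OF j] hi[OF j] g nz])
        fix f :: "real \<Rightarrow> real"
        assume f: "half_trig_poly (n j - 1) (\<lambda>\<theta>. of_real (f \<theta>))"
        have int: "integrable (\<mu> j) (\<lambda>z. c * (\<psi> (arg_from t0 z) * of_real (f (arg_from t0 z))))"
          using half_trig_poly_integrable[OF prob[OF j] half_trig_poly_cmult[OF half_trig_poly_mult[OF \<psi> f]]] .
        have "(\<integral>z. g (arg_from t0 z) * f (arg_from t0 z) \<partial>\<mu> j) =
            (\<integral>z. Re (c * (\<psi> (arg_from t0 z) * of_real (f (arg_from t0 z)))) \<partial>\<mu> j)"
          by (simp add: g_def algebra_simps)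
        also have "\<dots> = Re (\<integral>z. c * (\<psi> (arg_from t0 z) * of_real (f (arg_from t0 z))) \<partial>\<mu> j)"
          using int by (rule integral_Re)
        also have "\<dots> = 0" using orth_\<psi>[OF j False f] by simp
        finally show "(\<integral>z. g (arg_from t0 z) * f (arg_from t0 z) \<partial>\<mu> j) = 0" .
      qed
    qed simp
    then have "N \<le> (\<Sum>j=1..r. card (Z j))" unfolding N index_size_def by (rule sum_mono)
    also have "\<dots> = card (\<Union>j\<in>{1..r}. Z j)"
    proof (rule card_UN_disjoint[symmetric])
      show "\<forall>j\<in>{1..r}. finite (Z j)" using ZW W(1) finite_subset by blast
      show "\<forall>j\<in>{1..r}. \<forall>k\<in>{1..r}. j \<noteq> k \<longrightarrow> Z j \<inter> Z k = {}"
      proof (intro ballI impI)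
        fix j k assume jk: "j \<in> {1..r}" "k \<in> {1..r}" "j \<noteq> k"
        then consider "\<beta> j \<le> \<alpha> k" | "\<beta> k \<le> \<alpha> j" using order by (meson linorder_neqE_nat)
        then show "Z j \<inter> Z k = {}" by cases (auto simp: Z_def)
      qed
    qed simp
    also have "\<dots> \<le> card W" using ZW W(1) by (intro card_mono UN_least)
    finally show False using W(2) False by simp
  qed
  have \<psi>0: "\<psi> \<theta> = 0" for \<theta> using Re0[of 1 \<theta>] Re0[of \<i> \<theta>] by (simp add: complex_eq_iff)
  \<comment> \<open>Vanishing of \<open>\<psi>\<close> at all angles makes every point of the circle
    a root of \<open>p\<close>.\<close>
  have "p = 0"
  proof (rule ccontr)
    assume "p \<noteq> 0"
    then have "finite {w. poly p w = 0}" by (rule poly_roots_finite)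
    moreover have "cis ` {0..<2 * pi} \<subseteq> {w. poly p w = 0}" using \<psi>0 by (auto simp: \<psi>_def)
    moreover have "inj_on cis {0..<2 * pi}"
      by (intro inj_onI cis_inj_interval[where ?t0.0 = 0]) auto
    ultimately have "finite {0..<2 * pi}" using finite_subset finite_imageD by blast
    then show False using pi_gt_zero by (simp add: infinite_Ico)
  qed
  show ?thesis
  proof (cases "i = 0")
    case False
    \<comment> \<open>The degrees \<open>N - l\<close> are distinct for \<open>l \<le> N\<close>, so
      only the term \<open>l = i\<close> survives.\<close>
    have "coeff p (N - i) = (\<Sum>l=1..N. if l = i then x l else 0)"
      unfolding p_def coeff_sum coeff_monom using i False by (intro sum.cong) auto
    also have "\<dots> = x i" using i False by simp
    finally show ?thesis using \<open>p = 0\<close> by simp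
  qed (use x0 in simp)
qed

section \<open>Normality as a square linear system\<close>

text \<open>Treating the leading coefficient as one more unknown, normalised to 1, makes the
  orthogonality conditions homogeneous linear equations.\<close>

lemma phi_form_iff:
  "phi_form t0 N \<phi> \<longleftrightarrow>
     (\<exists>x. x 0 = 1 \<and> \<phi> = (\<lambda>z. \<Sum>i\<le>N. x i * half_pow t0 (int N - 2 * int i) z))"
proof -
  have *: "(\<Sum>i\<le>N. x i * half_pow t0 (int N - 2 * int i) z) =
     x 0 * half_pow t0 (int N) z + (\<Sum>i=1..N. x i * half_pow t0 (int N - 2 * int i) z)" for x z
    by (simp add: sum.atMost_shift sum.atLeast1_atMost_eq)
  show ?thesis
  proof
    assume "phi_form t0 N \<phi>"
    then obtain \<kappa> where "\<phi> = (\<lambda>z. half_pow t0 (int N) z + (\<Sum>l=1..N. \<kappa> l * half_pow t0 (int N - 2 * int l) z))"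
      by (auto simp: phi_form_def)
    then show "\<exists>x. x 0 = 1 \<and> \<phi> = (\<lambda>z. \<Sum>i\<le>N. x i * half_pow t0 (int N - 2 * int i) z)"
      unfolding * by (intro exI[of _ "\<kappa>(0 := 1)"]) auto
  next
    assume "\<exists>x. x 0 = 1 \<and> \<phi> = (\<lambda>z. \<Sum>i\<le>N. x i * half_pow t0 (int N - 2 * int i) z)"
    then show "phi_form t0 N \<phi>" unfolding phi_form_def * by auto
  qed
qed

theorem theorem4p3:
  fixes r :: nat and \<mu> :: "nat \<Rightarrow> complex measure" and \<Gamma> :: "nat \<Rightarrow> complex set" and t0 :: real
  assumes "r \<ge> 1"
    and "angelesco_system r \<mu> \<Gamma>"
    and "ordered_arcs t0 r \<Gamma>"
    and "measure (\<mu> r) {cis t0} = 0"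
  shows "\<forall>n :: nat \<Rightarrow> nat. phi_normal t0 r \<mu> n"
proof
  fix n :: "nat \<Rightarrow> nat"
  define N where "N = index_size r n"
  define \<Phi> where "\<Phi> x z = (\<Sum>i\<le>N. x i * half_pow t0 (int N - 2 * int i) z)" for x z
  define a where "a = (\<lambda>(j, l) i. \<integral>z. half_pow t0 (int N - 2 * int i) z
      * half_pow t0 (int (n j) - 2 * int l) z \<partial>\<mu> j)"
  have int: "(\<integral>z. \<Phi> x z * half_pow t0 (int (n j) - 2 * int l) z \<partial>\<mu> j) = (\<Sum>i\<le>N. x i * a (j, l) i)"
    if "j \<in> {1..r}" for x j l
    using assms(2) that unfolding \<Phi>_def a_def
    by (simp add: integral_half_pow_sum angelesco_system_def)
  have triv: "x i = 0" if "x 0 = 0" "i \<le> N"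
      "\<And>j l. j \<in> {1..r} \<Longrightarrow> l < n j \<Longrightarrow> (\<Sum>i\<le>N. x i * a (j, l) i) = 0" for x i
    using homogeneous_trivial[OF assms(2-4) N_def, of x i] that int[of _ x]
    unfolding \<Phi>_def by simp
  let ?P = "\<lambda>\<phi>. phi_form t0 N \<phi> \<and> (\<forall>j\<in>{1..r}. \<forall>l<n j.
              (\<integral>z. \<phi> z * half_pow t0 (int (n j) - 2 * int l) z \<partial>\<mu> j) = 0)"
  have "\<exists>!\<phi>. ?P \<phi>"
  proof (rule ex_ex1I)
    \<comment> \<open>One equation for each pair \<open>(j, l)\<close>, hence \<open>N\<close> in
      total, against the \<open>N + 1\<close> unknowns indexed by \<open>{..N}\<close>.\<close>
    let ?I = "SIGMA j:{1..r}. {..<n j}"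
    have "finite ?I" "card ?I < card {..N}"
      by (simp_all add: N_def index_size_def card_SigmaI)
    then obtain x where x: "\<exists>i\<in>{..N}. x i \<noteq> 0" "\<forall>e\<in>?I. (\<Sum>i\<le>N. a e i * x i) = 0"
      using underdetermined_system[of ?I "{..N}" a] by auto
    have x': "(\<Sum>i\<le>N. x i * a (j, l) i) = 0" if "j \<in> {1..r}" "l < n j" for j l
      using x(2) that by (auto simp: mult.commute)
    \<comment> \<open>Otherwise \<open>triv\<close> would make the nontrivial solution vanish; so it
      can be scaled to leading coefficient 1.\<close>
    have "x 0 \<noteq> 0" using triv[of x] x(1) x' by auto
    define y where "y i = x i / x 0" for i
    have "phi_form t0 N (\<Phi> y)"
      unfolding phi_form_iff \<Phi>_def using \<open>x 0 \<noteq> 0\<close> by (intro exI[of _ y]) (auto simp: y_def)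
    moreover have "(\<Sum>i\<le>N. y i * a (j, l) i) = 0" if "j \<in> {1..r}" "l < n j" for j l
      using x'[OF that] by (simp add: y_def sum_divide_distrib[symmetric])
    ultimately show "\<exists>\<phi>. ?P \<phi>" using int by (intro exI[of _ "\<Phi> y"]) simp
  next
    fix \<phi> \<phi>' assume P: "?P \<phi>" "?P \<phi>'"
    then obtain x x' where x: "x 0 = 1" "\<phi> = \<Phi> x" "x' 0 = 1" "\<phi>' = \<Phi> x'"
      unfolding phi_form_iff \<Phi>_def by blast
    \<comment> \<open>Uniqueness is proved for the coefficients, so the two functions agree at every
      complex \<open>z\<close> and not only on the circle.\<close>
    have "x i - x' i = 0" if "i \<le> N" for i
    proof (rule triv[of "\<lambda>i. x i - x' i"])
      fix j l assume jl: "j \<in> {1..r}" "l < n j"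
      have "(\<Sum>i\<le>N. x i * a (j, l) i) = 0" "(\<Sum>i\<le>N. x' i * a (j, l) i) = 0"
        unfolding int[OF jl(1), symmetric] using P jl x by blast+
      then show "(\<Sum>i\<le>N. (x i - x' i) * a (j, l) i) = 0"
        by (simp add: left_diff_distrib sum_subtractf)
    qed (use x that in auto)
    then show "\<phi> = \<phi>'" by (auto simp: x \<Phi>_def)
  qed
  then show "phi_normal t0 r \<mu> n" unfolding phi_normal_def N_def .
qed

end
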